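(* Let $f$ be a rational function over $\mathbb{Q}_p$ of the form $f(x)=P_1(x)/Q_1(x)$ with $P_1(x)=a_{n+1}x^{n+1}+a_nx^n+\cdots+a_0$ and $Q_1(x)=b_nx^n+\cdots+b_0$ in $\mathbb{Q}_p[x]$, $a_{n+1},b_n\in\mathbb{Z}_p^{\times}$, and $Q_1$ having no root in $\mathbb{Q}_p$. Write $f'(x)=P_2(x)/Q_2(x)$ where $P_2,Q_2\in\mathbb{Q}_p[x]$ have the same degree $n'$ and leading coefficients in $\mathbb{Z}_p^{\times}$. Let $N$ be a positive integer such that $p^N>\max_{0\le i\le n}|a_i|$, $p^N>\max_{0\le j\le n-1}|b_j|$, and $|P_2(x)|=|Q_2(x)|=|x|^{n'}$ whenever $|x|\ge p^N$. Then $f$ is an invertible local isometry on $\mathbb{Q}_p$ if and only if $f(B_{p^{N-1}}(0))\subset B_{p^{N-1}}(0)$ and $f|_{B_{p^{N-1}}(0)}$ is invertible and locally isometric (as a map of $B_{p^{N-1}}(0)$ to itself).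
   Context: $|\cdot|$ is the $p$-adic absolute value and $B_r(a)=\{x\in\mathbb{Q}_p:|x-a|\le r\}$. A map $g:X\to X$ on an open set $X\subset\mathbb{Q}_p$ is locally isometric (a local isometry) if for every $a\in X$ there is $r>0$ with $|g(x)-g(y)|=|x-y|$ for all $x,y\in B_r(a)$; it is invertible if it is bijective. A maximum over an empty index set imposes no condition. *)

theory Defs
  imports
    "HOL-Analysis.Analysis"
    "Berlekamp_Zassenhaus.Finite_Field"
    "HOL-Computational_Algebra.Fraction_Field"
    "HOL-Computational_Algebra.Squarefree"
    "HOL-Computational_Algebra.Polynomial"
begin

section \<open>The \<open>p\<close>-adic absolute value on the rationals\<close>

definition padic_abs :: "nat \<Rightarrow> rat \<Rightarrow> real" where
  "padic_abs p x = (if x = 0 then 0 else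
     real p powi (int (multiplicity (int p) (snd (quotient_of x)))
                - int (multiplicity (int p) (fst (quotient_of x)))))"

lemma padic_abs_frac:
  assumes "prime p" "a \<noteq> 0" "b \<noteq> 0"
  shows "padic_abs p (of_int a / of_int b) =
    real p powi (int (multiplicity (int p) b) - int (multiplicity (int p) a))"
proof -
  define x :: rat where "x = of_int a / of_int b"
  obtain u v where uv: "quotient_of x = (u, v)" by (cases "quotient_of x")
  have x: "x = of_int u / of_int v" and v: "v > 0"
    using quotient_of_div[OF uv] quotient_of_denom_pos[OF uv] by auto
  have x0: "x \<noteq> 0" using assms by (simp add: x_def)
  then have u: "u \<noteq> 0" using x by auto
  have "of_int (a * v) = (of_int (u * b) :: rat)"
    using x x_def assms v by (simp add: field_simps)
  then have eq: "a * v = u * b" by linarith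
  have pe: "prime_elem (int p)" using assms(1) by simp
  have "multiplicity (int p) a + multiplicity (int p) v = multiplicity (int p) (a * v)"
    using prime_elem_multiplicity_mult_distrib[OF pe] assms v by simp
  also have "\<dots> = multiplicity (int p) u + multiplicity (int p) b"
    using prime_elem_multiplicity_mult_distrib[OF pe] assms u eq by simp
  finally have "int (multiplicity (int p) v) - int (multiplicity (int p) u)
      = int (multiplicity (int p) b) - int (multiplicity (int p) a)" by linarith
  then show ?thesis using x0 unfolding padic_abs_def x_def[symmetric] uv by simp
qed

lemma rat_int_frac:
  fixes x :: rat obtains a b :: int where "b \<noteq> 0" "x = of_int a / of_int b"
proof -
  obtain u v where uv: "quotient_of x = (u, v)" by (cases "quotient_of x")
  show ?thesis using that[of v u] quotient_of_div[OF uv] quotient_of_denom_pos[OF uv] by auto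
qed

lemma padic_abs_0 [simp]: "padic_abs p 0 = 0" by (simp add: padic_abs_def)

lemma padic_abs_1 [simp]: "padic_abs p 1 = 1" by (simp add: padic_abs_def)

lemma padic_abs_nonneg [simp]: "0 \<le> padic_abs p x" by (simp add: padic_abs_def)

lemma padic_abs_eq_0 [simp]: "prime p \<Longrightarrow> padic_abs p x = 0 \<longleftrightarrow> x = 0"
  by (auto simp: padic_abs_def)

lemma padic_abs_minus [simp]: "padic_abs p (- x) = padic_abs p x"
  by (auto simp: padic_abs_def rat_uminus_code Let_def multiplicity_uminus_right split: prod.splits)

lemma padic_abs_minus_commute: "padic_abs p (x - y) = padic_abs p (y - x)"
  by (metis minus_diff_eq padic_abs_minus)

lemma padic_abs_mult:
  assumes "prime p"
  shows "padic_abs p (x * y) = padic_abs p x * padic_abs p y"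
proof (cases "x = 0 \<or> y = 0")
  case False
  obtain a b where ab: "b \<noteq> 0" "x = of_int a / of_int b" by (rule rat_int_frac)
  obtain c d where cd: "d \<noteq> 0" "y = of_int c / of_int d" by (rule rat_int_frac)
  have nz: "a \<noteq> 0" "c \<noteq> 0" using False ab cd by auto
  have xy: "x * y = of_int (a * c) / of_int (b * d)" using ab cd by simp
  have pe: "prime_elem (int p)" using assms by simp
  have p0: "real p \<noteq> 0" using assms by auto
  have "padic_abs p (x * y) = real p powi
     ((int (multiplicity (int p) b) - int (multiplicity (int p) a))
    + (int (multiplicity (int p) d) - int (multiplicity (int p) c)))"
    unfolding xy using nz ab cd assms
    by (subst padic_abs_frac) (auto simp: prime_elem_multiplicity_mult_distrib[OF pe] algebra_simps)
  also have "\<dots> = padic_abs p x * padic_abs p y"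
    unfolding ab(2) cd(2) using nz ab(1) cd(1) assms p0
    by (subst power_int_add) (auto simp: padic_abs_frac)
  finally show ?thesis .
qed auto

lemma padic_abs_inverse:
  assumes "prime p"
  shows "padic_abs p (inverse x) = inverse (padic_abs p x)"
proof (cases "x = 0")
  case False
  then have "padic_abs p x * padic_abs p (inverse x) = 1"
    by (simp flip: padic_abs_mult[OF assms])
  then show ?thesis by (metis inverse_unique)
qed auto

lemma padic_abs_ultrametric:
  assumes "prime p"
  shows "padic_abs p (x + y) \<le> max (padic_abs p x) (padic_abs p y)"
proof (cases "x = 0 \<or> y = 0 \<or> x + y = 0")
  case True
  then show ?thesis by (auto simp: max_def)
next
  case False
  obtain a b where ab: "b \<noteq> 0" "x = of_int a / of_int b" by (rule rat_int_frac)
  obtain c d where cd: "d \<noteq> 0" "y = of_int c / of_int d" by (rule rat_int_frac)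
  define u v w where "u = a * d" "v = c * b" "w = b * d"
  have w: "w \<noteq> 0" and x: "x = of_int u / of_int w" and y: "y = of_int v / of_int w"
    using ab cd by (auto simp: u_v_w_def)
  have xy: "x + y = of_int (u + v) / of_int w" by (simp add: x y add_divide_distrib)
  have nz: "u \<noteq> 0" "v \<noteq> 0" "u + v \<noteq> 0" using False x y xy by auto
  let ?m = "multiplicity (int p)"
  have "int p ^ min (?m u) (?m v) dvd u + v"
    by (intro dvd_add) (auto intro: multiplicity_dvd')
  moreover have "\<not> is_unit (int p)" using assms by auto
  ultimately have "min (?m u) (?m v) \<le> ?m (u + v)"
    using nz by (intro multiplicity_geI) auto
  then consider "?m u \<le> ?m (u + v)" | "?m v \<le> ?m (u + v)" by linarith
  moreover have p1: "1 \<le> real p" using prime_gt_0_nat[OF assms] by linarith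
  moreover have "padic_abs p x = real p powi (int (?m w) - int (?m u))"
    unfolding x by (rule padic_abs_frac[OF assms nz(1) w])
  moreover have "padic_abs p y = real p powi (int (?m w) - int (?m v))"
    unfolding y by (rule padic_abs_frac[OF assms nz(2) w])
  moreover have "padic_abs p (x + y) = real p powi (int (?m w) - int (?m (u + v)))"
    unfolding xy by (rule padic_abs_frac[OF assms nz(3) w])
  ultimately show ?thesis
    by cases (auto simp: le_max_iff_disj intro!: power_int_increasing)
qed

lemma padic_abs_triangle:
  assumes "prime p"
  shows "padic_abs p (x + y) \<le> padic_abs p x + padic_abs p y"
  using padic_abs_ultrametric[OF assms, of x y] padic_abs_nonneg[of p x] padic_abs_nonneg[of p y]
  by linarith

lemma padic_abs_diff_triangle:
  assumes "prime p"
  shows "padic_abs p (x - z) \<le> max (padic_abs p (x - y)) (padic_abs p (y - z))"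
  using padic_abs_ultrametric[OF assms, of "x - y" "y - z"] by simp

lemma padic_abs_reverse_triangle:
  assumes "prime p"
  shows "\<bar>padic_abs p x - padic_abs p y\<bar> \<le> padic_abs p (x - y)"
  using padic_abs_triangle[OF assms, of "x - y" y] padic_abs_triangle[OF assms, of "y - x" x]
    padic_abs_minus_commute[of p x y] by simp


section \<open>Cauchy sequences\<close>

definition padic_Cauchy :: "nat \<Rightarrow> (nat \<Rightarrow> rat) \<Rightarrow> bool" where
  "padic_Cauchy p X \<longleftrightarrow> (\<forall>e>0. \<exists>k. \<forall>m\<ge>k. \<forall>n\<ge>k. padic_abs p (X m - X n) < e)"

definition padic_rel :: "nat \<Rightarrow> ((nat \<Rightarrow> rat) \<times> (nat \<Rightarrow> rat)) set" where
  "padic_rel p = {(X, Y). padic_Cauchy p X \<and> padic_Cauchy p Y \<and>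
                          (\<lambda>n. padic_abs p (X n - Y n)) \<longlonglongrightarrow> 0}"

lemma padic_Cauchy_iff:
  assumes "prime p"
  shows "padic_Cauchy p X \<longleftrightarrow> (\<lambda>n. padic_abs p (X (Suc n) - X n)) \<longlonglongrightarrow> 0"
proof
  assume X: "padic_Cauchy p X"
  show "(\<lambda>n. padic_abs p (X (Suc n) - X n)) \<longlonglongrightarrow> 0"
  proof (rule LIMSEQ_I)
    fix e :: real assume "e > 0"
    then obtain k where "\<forall>m\<ge>k. \<forall>n\<ge>k. padic_abs p (X m - X n) < e"
      using X unfolding padic_Cauchy_def by blast
    then show "\<exists>k. \<forall>n\<ge>k. norm (padic_abs p (X (Suc n) - X n) - 0) < e"
      by (intro exI[of _ k]) auto
  qed
next
  assume L: "(\<lambda>n. padic_abs p (X (Suc n) - X n)) \<longlonglongrightarrow> 0"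
  show "padic_Cauchy p X" unfolding padic_Cauchy_def
  proof (intro allI impI)
    fix e :: real assume e: "e > 0"
    then obtain k where k: "\<And>n. n \<ge> k \<Longrightarrow> padic_abs p (X (Suc n) - X n) < e"
      using LIMSEQ_D[OF L e] by auto
    have *: "padic_abs p (X m - X n) < e" if "n \<ge> k" "m \<ge> n" for m n
      using that(2)
    proof (induction m rule: dec_induct)
      case (step m)
      then show ?case
        using padic_abs_diff_triangle[OF assms, of "X (Suc m)" "X n" "X m"] k[of m] that(1)
        by linarith
    qed (use e in simp)
    have "padic_abs p (X m - X n) < e" if "n \<ge> k" "m \<ge> k" for m n
      using *[of n m] *[of m n] that padic_abs_minus_commute[of p "X m" "X n"] by (cases "m \<ge> n") auto
    then show "\<exists>k. \<forall>m\<ge>k. \<forall>n\<ge>k. padic_abs p (X m - X n) < e" by blast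
  qed
qed

lemma padic_null_le:
  assumes "g \<longlonglongrightarrow> 0" "\<And>n. padic_abs p (X n) \<le> g n"
  shows "(\<lambda>n. padic_abs p (X n)) \<longlonglongrightarrow> 0"
  by (rule tendsto_sandwich[OF _ _ tendsto_const assms(1)]) (auto intro!: always_eventually assms)

lemma padic_null_add:
  assumes "prime p" "(\<lambda>n. padic_abs p (X n)) \<longlonglongrightarrow> 0" "(\<lambda>n. padic_abs p (Y n)) \<longlonglongrightarrow> 0"
  shows "(\<lambda>n. padic_abs p (X n + Y n)) \<longlonglongrightarrow> 0"
  by (rule padic_null_le[OF tendsto_add_zero[OF assms(2,3)]]) (rule padic_abs_triangle[OF assms(1)])

lemma padic_Cauchy_const [simp]: "padic_Cauchy p (\<lambda>n. x)"
  by (auto simp: padic_Cauchy_def)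

lemma padic_Cauchy_uminus: "padic_Cauchy p X \<Longrightarrow> padic_Cauchy p (\<lambda>n. - X n)"
  unfolding padic_Cauchy_def by (simp add: padic_abs_minus_commute)

lemma padic_Cauchy_add:
  assumes p: "prime p" and "padic_Cauchy p X" "padic_Cauchy p Y"
  shows "padic_Cauchy p (\<lambda>n. X n + Y n)"
  using padic_null_add[OF p, of "\<lambda>n. X (Suc n) - X n" "\<lambda>n. Y (Suc n) - Y n"] assms
  by (simp add: padic_Cauchy_iff[OF p] algebra_simps)

lemma padic_Cauchy_diff:
  assumes p: "prime p" and "padic_Cauchy p X" "padic_Cauchy p Y"
  shows "padic_Cauchy p (\<lambda>n. X n - Y n)"
  using padic_Cauchy_add[OF p assms(2) padic_Cauchy_uminus[OF assms(3)]] by simp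

lemma padic_Cauchy_convergent_abs:
  assumes p: "prime p" and X: "padic_Cauchy p X"
  shows "convergent (\<lambda>n. padic_abs p (X n))"
proof (rule Cauchy_convergent, rule CauchyI)
  fix e :: real assume "e > 0"
  then obtain k where "\<forall>m\<ge>k. \<forall>n\<ge>k. padic_abs p (X m - X n) < e"
    using X unfolding padic_Cauchy_def by blast
  then have "\<forall>m\<ge>k. \<forall>n\<ge>k. norm (padic_abs p (X m) - padic_abs p (X n)) < e"
    using le_less_trans[OF padic_abs_reverse_triangle[OF p]] by simp
  then show "\<exists>k. \<forall>m\<ge>k. \<forall>n\<ge>k. norm (padic_abs p (X m) - padic_abs p (X n)) < e" ..
qed

lemma padic_Cauchy_bounded:
  assumes p: "prime p" and X: "padic_Cauchy p X"
  obtains B where "\<And>n. padic_abs p (X n) \<le> B"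
  using Bseq_def convergent_imp_Bseq[OF padic_Cauchy_convergent_abs[OF assms]]
  by (metis abs_of_nonneg padic_abs_nonneg real_norm_def)

lemma padic_null_mult:
  assumes p: "prime p" and X: "padic_Cauchy p X" and Y: "(\<lambda>n. padic_abs p (Y n)) \<longlonglongrightarrow> 0"
  shows "(\<lambda>n. padic_abs p (X n * Y n)) \<longlonglongrightarrow> 0"
proof -
  obtain B where B: "\<And>n. padic_abs p (X n) \<le> B" using padic_Cauchy_bounded[OF p X] by blast
  show ?thesis
    by (rule padic_null_le[of "\<lambda>n. B * padic_abs p (Y n)"])
       (auto simp: padic_abs_mult[OF p] intro!: mult_right_mono B tendsto_mult_right_zero Y)
qed

lemma padic_Cauchy_Suc: "padic_Cauchy p X \<Longrightarrow> padic_Cauchy p (\<lambda>n. X (Suc n))"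
  unfolding padic_Cauchy_def by (meson le_Suc_eq)

lemma padic_Cauchy_mult:
  assumes p: "prime p" and X: "padic_Cauchy p X" and Y: "padic_Cauchy p Y"
  shows "padic_Cauchy p (\<lambda>n. X n * Y n)"
proof -
  have "(\<lambda>n. padic_abs p (X (Suc n) * (Y (Suc n) - Y n) + Y n * (X (Suc n) - X n))) \<longlonglongrightarrow> 0"
    using X Y by (intro padic_null_add[OF p] padic_null_mult[OF p] padic_Cauchy_Suc)
      (auto simp: padic_Cauchy_iff[OF p])
  then show ?thesis unfolding padic_Cauchy_iff[OF p] by (simp add: algebra_simps)
qed

lemma padic_null_diff_inverse:
  assumes p: "prime p" and "(\<lambda>n. padic_abs p (X n)) \<longlonglongrightarrow> a" "a \<noteq> 0"
    "(\<lambda>n. padic_abs p (Y n)) \<longlonglongrightarrow> b" "b \<noteq> 0" "(\<lambda>n. padic_abs p (X n - Y n)) \<longlonglongrightarrow> 0"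
  shows "(\<lambda>n. padic_abs p (inverse (X n) - inverse (Y n))) \<longlonglongrightarrow> 0"
proof -
  have "\<forall>\<^sub>F n in sequentially. padic_abs p (X n) \<noteq> 0"
    by (rule tendsto_imp_eventually_ne[OF assms(2,3)])
  moreover have "\<forall>\<^sub>F n in sequentially. padic_abs p (Y n) \<noteq> 0"
    by (rule tendsto_imp_eventually_ne[OF assms(4,5)])
  ultimately have "\<forall>\<^sub>F n in sequentially.
      inverse (padic_abs p (X n)) * padic_abs p (X n - Y n) * inverse (padic_abs p (Y n))
      = padic_abs p (inverse (X n) - inverse (Y n))"
    by eventually_elim
       (use p in \<open>simp add: inverse_diff_inverse padic_abs_mult padic_abs_inverse\<close>)
  moreover have "(\<lambda>n. inverse (padic_abs p (X n)) * padic_abs p (X n - Y n)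
      * inverse (padic_abs p (Y n))) \<longlonglongrightarrow> inverse a * 0 * inverse b"
    by (intro tendsto_mult[OF tendsto_mult[OF tendsto_inverse[OF assms(2,3)] assms(6)]
          tendsto_inverse[OF assms(4,5)]])
  ultimately show ?thesis using Lim_transform_eventually by force
qed

lemma padic_Cauchy_inverse:
  assumes p: "prime p" and X: "padic_Cauchy p X" and nz: "\<not> (\<lambda>n. padic_abs p (X n)) \<longlonglongrightarrow> 0"
  shows "padic_Cauchy p (\<lambda>n. inverse (X n))"
proof -
  obtain a where a: "(\<lambda>n. padic_abs p (X n)) \<longlonglongrightarrow> a"
    using padic_Cauchy_convergent_abs[OF p X] by (auto simp: convergent_def)
  with nz have "a \<noteq> 0" by auto
  then show ?thesis unfolding padic_Cauchy_iff[OF p]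
    using a LIMSEQ_Suc[OF a] X by (intro padic_null_diff_inverse[OF p, of _ a _ a])
      (auto simp: padic_Cauchy_iff[OF p])
qed

lemma equiv_padic_rel:
  assumes p: "prime p"
  shows "equiv {X. padic_Cauchy p X} (padic_rel p)"
proof (rule equivI)
  show "trans (padic_rel p)"
  proof (rule transI)
    fix X Y Z assume "(X, Y) \<in> padic_rel p" "(Y, Z) \<in> padic_rel p"
    then show "(X, Z) \<in> padic_rel p"
      using padic_null_add[OF p, of "\<lambda>n. X n - Y n" "\<lambda>n. Y n - Z n"]
      by (auto simp: padic_rel_def)
  qed
qed (auto simp: padic_rel_def refl_on_def sym_def padic_abs_minus_commute)


section \<open>The field of \<open>p\<close>-adic numbers\<close>

text \<open>
  The completion of the rationals with respect to the \<open>p\<close>-adic absolute value. The prime is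
  carried by the type parameter, as for \<open>mod_ring\<close>: \<open>p = CARD('p)\<close>.
\<close>

typedef (overloaded) ('p::prime_card) padic =
  "{X. padic_Cauchy CARD('p) X} // padic_rel CARD('p)"
  by (auto simp: quotient_def intro: padic_Cauchy_const)

definition Padic :: "(nat \<Rightarrow> rat) \<Rightarrow> 'p::prime_card padic" where
  "Padic X = Abs_padic (padic_rel CARD('p) `` {X})"

definition padic_seq :: "'p::prime_card padic \<Rightarrow> nat \<Rightarrow> rat" where
  "padic_seq x = (SOME X. X \<in> Rep_padic x)"

lemma Padic_cases:
  fixes x :: "'p::prime_card padic"
  obtains X where "padic_Cauchy CARD('p) X" "x = Padic X"
proof -
  have "Rep_padic x \<in> {X. padic_Cauchy CARD('p) X} // padic_rel CARD('p)" by (rule Rep_padic)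
  then obtain X where "padic_Cauchy CARD('p) X" "Rep_padic x = padic_rel CARD('p) `` {X}"
    by (auto elim: quotientE)
  then show ?thesis using that[of X] by (metis Padic_def Rep_padic_inverse)
qed

lemma Padic_eq_iff:
  assumes "padic_Cauchy CARD('p) X" "padic_Cauchy CARD('p) Y"
  shows "(Padic X :: 'p::prime_card padic) = Padic Y \<longleftrightarrow>
    (\<lambda>n. padic_abs CARD('p) (X n - Y n)) \<longlonglongrightarrow> 0"
proof -
  note E = equiv_padic_rel[OF prime_card[where 'a='p]]
  have "(Padic X :: 'p padic) = Padic Y \<longleftrightarrow> padic_rel CARD('p) `` {X} = padic_rel CARD('p) `` {Y}"
    unfolding Padic_def using assms by (intro Abs_padic_inject quotientI) auto
  also have "\<dots> \<longleftrightarrow> (X, Y) \<in> padic_rel CARD('p)"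
    using assms by (intro eq_equiv_class_iff[OF E]) auto
  finally show ?thesis using assms by (simp add: padic_rel_def)
qed

lemma padic_seq:
  fixes x :: "'p::prime_card padic"
  shows "padic_Cauchy CARD('p) (padic_seq x)" "Padic (padic_seq x) = x"
proof -
  obtain X where X: "padic_Cauchy CARD('p) X" "x = Padic X" by (rule Padic_cases)
  have R: "Rep_padic x = padic_rel CARD('p) `` {X}"
    unfolding X(2) Padic_def using X(1) by (intro Abs_padic_inverse quotientI) auto
  have "X \<in> Rep_padic x" using X(1) unfolding R by (auto simp: padic_rel_def)
  then have "padic_seq x \<in> Rep_padic x" unfolding padic_seq_def by (rule someI[of "\<lambda>X. X \<in> Rep_padic x"])
  then have *: "(X, padic_seq x) \<in> padic_rel CARD('p)" unfolding R by auto
  then show c: "padic_Cauchy CARD('p) (padic_seq x)" by (simp add: padic_rel_def)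
  have "(Padic X :: 'p padic) = Padic (padic_seq x)"
    using * X(1) c by (subst Padic_eq_iff) (auto simp: padic_rel_def)
  then show "Padic (padic_seq x) = x" using X(2) by simp
qed

lemma padic_seq_Padic:
  assumes "padic_Cauchy CARD('p) X"
  shows "(\<lambda>n. padic_abs CARD('p) (padic_seq (Padic X :: 'p::prime_card padic) n - X n)) \<longlonglongrightarrow> 0"
  using Padic_eq_iff[OF padic_seq(1) assms, of "Padic X"] padic_seq(2)[of "Padic X :: 'p padic"] by simp

instantiation padic :: (prime_card) comm_ring_1
begin

definition zero_padic :: "'a padic" where "0 = Padic (\<lambda>n. 0)"
definition one_padic :: "'a padic" where "1 = Padic (\<lambda>n. 1)"
definition plus_padic :: "'a padic \<Rightarrow> 'a padic \<Rightarrow> 'a padic" where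
  "x + y = Padic (\<lambda>n. padic_seq x n + padic_seq y n)"
definition uminus_padic :: "'a padic \<Rightarrow> 'a padic" where
  "- x = Padic (\<lambda>n. - padic_seq x n)"
definition minus_padic :: "'a padic \<Rightarrow> 'a padic \<Rightarrow> 'a padic" where
  "x - y = x + - (y :: 'a padic)"
definition times_padic :: "'a padic \<Rightarrow> 'a padic \<Rightarrow> 'a padic" where
  "x * y = Padic (\<lambda>n. padic_seq x n * padic_seq y n)"

lemma Padic_add:
  assumes "padic_Cauchy CARD('a) X" "padic_Cauchy CARD('a) Y"
  shows "Padic X + Padic Y = (Padic (\<lambda>n. X n + Y n) :: 'a padic)"
  unfolding plus_padic_def
proof (subst Padic_eq_iff)
  show "(\<lambda>n. padic_abs CARD('a) (padic_seq (Padic X :: 'a padic) n + padic_seq (Padic Y :: 'a padic) n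
      - (X n + Y n))) \<longlonglongrightarrow> 0"
    using padic_null_add[OF prime_card padic_seq_Padic[OF assms(1)] padic_seq_Padic[OF assms(2)]]
    by (simp add: algebra_simps)
qed (intro padic_Cauchy_add prime_card padic_seq(1) assms)+

lemma Padic_uminus:
  assumes "padic_Cauchy CARD('a) X"
  shows "- Padic X = (Padic (\<lambda>n. - X n) :: 'a padic)"
  unfolding uminus_padic_def
  by (subst Padic_eq_iff)
     (use padic_seq_Padic[OF assms] in \<open>auto intro!: padic_Cauchy_uminus padic_seq(1) assms
        simp: padic_abs_minus_commute\<close>)

lemma Padic_diff:
  assumes "padic_Cauchy CARD('a) X" "padic_Cauchy CARD('a) Y"
  shows "Padic X - Padic Y = (Padic (\<lambda>n. X n - Y n) :: 'a padic)"
  using assms by (simp add: minus_padic_def Padic_uminus Padic_add padic_Cauchy_uminus)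

lemma Padic_mult:
  assumes "padic_Cauchy CARD('a) X" "padic_Cauchy CARD('a) Y"
  shows "Padic X * Padic Y = (Padic (\<lambda>n. X n * Y n) :: 'a padic)"
  unfolding times_padic_def
proof (subst Padic_eq_iff)
  let ?X = "padic_seq (Padic X :: 'a padic)" and ?Y = "padic_seq (Padic Y :: 'a padic)"
  have "(\<lambda>n. padic_abs CARD('a) (?X n * (?Y n - Y n) + Y n * (?X n - X n))) \<longlonglongrightarrow> 0"
    by (intro padic_null_add padic_null_mult prime_card padic_seq(1) padic_seq_Padic assms)
  then show "(\<lambda>n. padic_abs CARD('a) (?X n * ?Y n - X n * Y n)) \<longlonglongrightarrow> 0"
    by (simp add: algebra_simps)
qed (intro padic_Cauchy_mult prime_card padic_seq(1) assms)+

lemma Padic_eq_0_iff: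
  assumes "padic_Cauchy CARD('a) X"
  shows "(Padic X :: 'a padic) = 0 \<longleftrightarrow> (\<lambda>n. padic_abs CARD('a) (X n)) \<longlonglongrightarrow> 0"
  unfolding zero_padic_def using assms by (subst Padic_eq_iff) auto

instance
proof
  fix x y z :: "'a padic"
  obtain X where X: "padic_Cauchy CARD('a) X" "x = Padic X" by (rule Padic_cases)
  obtain Y where Y: "padic_Cauchy CARD('a) Y" "y = Padic Y" by (rule Padic_cases)
  obtain Z where Z: "padic_Cauchy CARD('a) Z" "z = Padic Z" by (rule Padic_cases)
  note c = X(1) Y(1) Z(1) padic_Cauchy_add[OF prime_card] padic_Cauchy_mult[OF prime_card]
  note d = Padic_add Padic_mult X(2) Y(2) Z(2)
  show "x + y + z = x + (y + z)" by (simp add: c d add.assoc)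
  show "x + y = y + x" by (simp add: c d add.commute)
  show "0 + x = x" by (simp add: zero_padic_def c d)
  show "- x + x = 0" by (simp add: zero_padic_def c d Padic_uminus padic_Cauchy_uminus)
  show "x - y = x + - y" by (simp add: minus_padic_def)
  show "x * y * z = x * (y * z)" by (simp add: c d mult.assoc)
  show "x * y = y * x" by (simp add: c d mult.commute)
  show "1 * x = x" by (simp add: one_padic_def c d)
  show "(x + y) * z = x * z + y * z" by (simp add: c d distrib_right)
  show "0 \<noteq> (1 :: 'a padic)" unfolding zero_padic_def one_padic_def
    by (subst Padic_eq_iff) (auto simp: LIMSEQ_const_iff)
qed

end

instantiation padic :: (prime_card) field
begin

definition inverse_padic :: "'a padic \<Rightarrow> 'a padic" where
  "inverse x = (if x = 0 then 0 else Padic (\<lambda>n. inverse (padic_seq x n)))"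
definition divide_padic :: "'a padic \<Rightarrow> 'a padic \<Rightarrow> 'a padic" where
  "divide x y = x * inverse (y :: 'a padic)"

instance
proof
  fix x y :: "'a padic"
  show "x div y = x * inverse y" by (simp add: divide_padic_def)
  show "inverse (0 :: 'a padic) = 0" by (simp add: inverse_padic_def)
next
  fix x :: "'a padic"
  assume "x \<noteq> 0"
  let ?X = "padic_seq x"
  have nz: "\<not> (\<lambda>n. padic_abs CARD('a) (?X n)) \<longlonglongrightarrow> 0"
    using \<open>x \<noteq> 0\<close> Padic_eq_0_iff[OF padic_seq(1), of x] by (simp add: padic_seq(2))
  have ci: "padic_Cauchy CARD('a) (\<lambda>n. inverse (?X n))"
    by (intro padic_Cauchy_inverse prime_card padic_seq(1) nz)
  have "inverse x * x = Padic (\<lambda>n. inverse (?X n)) * Padic ?X"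
    using \<open>x \<noteq> 0\<close> by (simp add: inverse_padic_def padic_seq(2))
  also have "\<dots> = Padic (\<lambda>n. inverse (?X n) * ?X n)" by (rule Padic_mult[OF ci padic_seq(1)])
  also have "\<dots> = 1" unfolding one_padic_def
  proof (subst Padic_eq_iff)
    obtain a where a: "(\<lambda>n. padic_abs CARD('a) (?X n)) \<longlonglongrightarrow> a"
      using padic_Cauchy_convergent_abs[OF prime_card padic_seq(1)] by (auto simp: convergent_def)
    with nz have "a \<noteq> 0" by auto
    then have "\<forall>\<^sub>F n in sequentially. padic_abs CARD('a) (?X n) \<noteq> 0"
      using a by (intro tendsto_imp_eventually_ne) auto
    then have "\<forall>\<^sub>F n in sequentially. padic_abs CARD('a) (inverse (?X n) * ?X n - 1) = 0"
    proof eventually_elim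
      case (elim n)
      then have "?X n \<noteq> 0" by (metis padic_abs_0)
      then have "inverse (?X n) * ?X n - 1 = 0" by simp
      then show ?case by (simp only: padic_abs_0)
    qed
    then show "(\<lambda>n. padic_abs CARD('a) (inverse (?X n) * ?X n - 1)) \<longlonglongrightarrow> 0"
      by (rule tendsto_eventually)
  qed (rule padic_Cauchy_mult[OF prime_card ci padic_seq(1)] padic_Cauchy_const)+
  finally show "inverse x * x = 1" .
qed

end

text \<open>The norm is the extension of the \<open>p\<close>-adic absolute value, normalised by \<open>|p| = 1/p\<close>.\<close>

definition padic_norm :: "'p::prime_card padic \<Rightarrow> real" where
  "padic_norm x = lim (\<lambda>n. padic_abs CARD('p) (padic_seq x n))"

lemma norm_Padic:
  assumes X: "padic_Cauchy CARD('p) X"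
  shows "(\<lambda>n. padic_abs CARD('p) (X n)) \<longlonglongrightarrow> padic_norm (Padic X :: 'p::prime_card padic)"
proof -
  let ?Y = "padic_seq (Padic X :: 'p padic)"
  have Y: "(\<lambda>n. padic_abs CARD('p) (?Y n)) \<longlonglongrightarrow> padic_norm (Padic X :: 'p padic)"
    unfolding padic_norm_def using padic_Cauchy_convergent_abs[OF prime_card padic_seq(1)]
    by (simp add: convergent_LIMSEQ_iff)
  have "(\<lambda>n. padic_abs CARD('p) (X n) - padic_abs CARD('p) (?Y n)) \<longlonglongrightarrow> 0"
  proof (rule Lim_null_comparison[OF always_eventually padic_seq_Padic[OF X]], rule allI)
    show "norm (padic_abs CARD('p) (X n) - padic_abs CARD('p) (?Y n))
       \<le> padic_abs CARD('p) (?Y n - X n)" for n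
      using padic_abs_reverse_triangle[OF prime_card[where 'a='p], of "X n" "?Y n"]
      by (simp add: padic_abs_minus_commute)
  qed
  from tendsto_add[OF this Y] show ?thesis by simp
qed

lemma
  fixes x y :: "'p::prime_card padic"
  shows padic_norm_eq_0 [simp]: "padic_norm x = 0 \<longleftrightarrow> x = 0" and padic_norm_nonneg [simp]: "padic_norm x \<ge> 0"
    and padic_norm_ultrametric: "padic_norm (x + y) \<le> max (padic_norm x) (padic_norm y)"
    and padic_norm_mult: "padic_norm (x * y) = padic_norm x * padic_norm y"
    and padic_norm_minus [simp]: "padic_norm (- x) = padic_norm x"
proof -
  obtain X where X: "padic_Cauchy CARD('p) X" "x = Padic X" by (rule Padic_cases)
  obtain Y where Y: "padic_Cauchy CARD('p) Y" "y = Padic Y" by (rule Padic_cases)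
  note LX = norm_Padic[OF X(1)] and LY = norm_Padic[OF Y(1)]
  show "padic_norm x = 0 \<longleftrightarrow> x = 0"
    unfolding X(2) by (metis LIMSEQ_unique LX Padic_eq_0_iff[OF X(1)])
  show "padic_norm x \<ge> 0" unfolding X(2) by (rule LIMSEQ_le_const[OF LX]) auto
  show "padic_norm (x + y) \<le> max (padic_norm x) (padic_norm y)"
    unfolding X(2) Y(2) Padic_add[OF X(1) Y(1)]
    by (rule LIMSEQ_le[OF norm_Padic[OF padic_Cauchy_add[OF prime_card X(1) Y(1)]]
          tendsto_max[OF LX LY]]) (auto intro!: padic_abs_ultrametric prime_card)
  have "(\<lambda>n. padic_abs CARD('p) (X n * Y n)) \<longlonglongrightarrow> padic_norm x * padic_norm y"
    unfolding X(2) Y(2) padic_abs_mult[OF prime_card] by (intro tendsto_mult LX LY)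
  then show "padic_norm (x * y) = padic_norm x * padic_norm y"
    unfolding X(2) Y(2) Padic_mult[OF X(1) Y(1)]
    by (rule LIMSEQ_unique[OF norm_Padic[OF padic_Cauchy_mult[OF prime_card X(1) Y(1)]]])
  show "padic_norm (- x) = padic_norm x"
    unfolding X(2) Padic_uminus[OF X(1)]
    by (rule LIMSEQ_unique[OF norm_Padic[OF padic_Cauchy_uminus[OF X(1)]]]) (use LX in simp)
qed

lemma padic_norm_minus_commute: "padic_norm (x - y) = padic_norm (y - x)"
  using padic_norm_minus[of "x - y"] by simp

lemma padic_norm_diff_ultrametric:
  "padic_norm (x - y) \<le> max (padic_norm (x - z)) (padic_norm (z - y))"
  using padic_norm_ultrametric[of "x - z" "z - y"] by simp

instantiation padic :: (prime_card) metric_space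
begin

definition dist_padic :: "'a padic \<Rightarrow> 'a padic \<Rightarrow> real" where
  "dist x y = padic_norm (x - y :: 'a padic)"
definition uniformity_padic :: "('a padic \<times> 'a padic) filter" where
  "(uniformity :: ('a padic \<times> 'a padic) filter) =
     (INF e\<in>{0<..}. principal {(x, y). dist x y < e})"
definition open_padic :: "'a padic set \<Rightarrow> bool" where
  "open (U :: 'a padic set) \<longleftrightarrow> (\<forall>x\<in>U. \<forall>\<^sub>F (x', y) in uniformity. x' = x \<longrightarrow> y \<in> U)"

instance
proof
  show "uniformity = (INF e\<in>{0<..}. principal {(x :: 'a padic, y). dist x y < e})"
    by (simp add: uniformity_padic_def)
  show "open U \<longleftrightarrow> (\<forall>x\<in>U. \<forall>\<^sub>F (x', y) in uniformity. x' = x \<longrightarrow> y \<in> U)" for U :: "'a padic set"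
    by (simp add: open_padic_def)
  fix x y z :: "'a padic"
  show "dist x y = 0 \<longleftrightarrow> x = y" by (simp add: dist_padic_def padic_norm_eq_0)
  have "padic_norm (x - y) \<le> max (padic_norm (x - z)) (padic_norm (y - z))"
    using padic_norm_diff_ultrametric[of x y z] padic_norm_minus_commute[of y z] by simp
  then show "dist x y \<le> dist x z + dist y z"
    unfolding dist_padic_def
    using padic_norm_nonneg[of "x - z"] padic_norm_nonneg[of "y - z"] by linarith
qed

end

lemma Padic_of_nat: "of_nat n = (Padic (\<lambda>_. of_nat n) :: 'p::prime_card padic)"
  by (induction n) (simp_all add: zero_padic_def one_padic_def Padic_add)

instance padic :: (prime_card) field_char_0
proof
  show "inj (of_nat :: nat \<Rightarrow> 'a padic)"
  proof (rule injI)
    fix m n :: nat assume "of_nat m = (of_nat n :: 'a padic)"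
    then have "(\<lambda>k::nat. padic_abs CARD('a) (of_nat m - of_nat n)) \<longlonglongrightarrow> 0"
      by (simp add: Padic_of_nat Padic_eq_iff)
    then show "m = n" by (simp add: LIMSEQ_const_iff prime_card)
  qed
qed

lemma Padic_of_int: "of_int n = (Padic (\<lambda>_. of_int n) :: 'p::prime_card padic)"
  by (cases n rule: int_cases2) (simp_all add: Padic_of_nat Padic_uminus)

lemma Padic_of_rat: "of_rat q = (Padic (\<lambda>_. q) :: 'p::prime_card padic)"
proof -
  obtain a b where ab: "b \<noteq> 0" "q = of_int a / of_int b" by (rule rat_int_frac)
  have "of_rat q * of_int b = (of_int a :: 'p padic)"
    using ab by (simp add: of_rat_divide)
  also have "\<dots> = Padic (\<lambda>_. q) * of_int b"
    using ab by (simp add: Padic_of_int Padic_mult)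
  finally show ?thesis using ab by simp
qed

text \<open>
  The three facts that characterise the completion: the padic_norm extends the \<open>p\<close>-adic absolute
  value, the rationals are dense, and the space is complete.
\<close>

lemma padic_norm_of_rat: "padic_norm (of_rat q :: 'p::prime_card padic) = padic_abs CARD('p) q"
  using norm_Padic[OF padic_Cauchy_const, of q, where 'p='p]
  by (simp add: Padic_of_rat LIMSEQ_const_iff)

lemma norm_Padic_diff_rat_le:
  assumes X: "padic_Cauchy CARD('p) X" and "\<And>n. n \<ge> k \<Longrightarrow> padic_abs CARD('p) (X n - q) \<le> e"
  shows "padic_norm (Padic X - of_rat q :: 'p::prime_card padic) \<le> e"
proof -
  have "Padic X - of_rat q = (Padic (\<lambda>n. X n - q) :: 'p padic)"
    by (simp add: Padic_of_rat Padic_diff X)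
  then show ?thesis
    using LIMSEQ_le_const2[OF norm_Padic[OF padic_Cauchy_diff[OF prime_card X padic_Cauchy_const]]]
      assms(2) by metis
qed

lemma padic_rat_dense:
  fixes x :: "'p::prime_card padic"
  assumes "e > 0"
  shows "\<exists>q. padic_norm (x - of_rat q) < e"
proof -
  obtain X where X: "padic_Cauchy CARD('p) X" "x = Padic X" by (rule Padic_cases)
  obtain k where "\<forall>m\<ge>k. \<forall>n\<ge>k. padic_abs CARD('p) (X m - X n) < e / 2"
    using X(1) assms unfolding padic_Cauchy_def by (meson half_gt_zero)
  then have "padic_norm (x - of_rat (X k)) \<le> e / 2"
    unfolding X(2) by (intro norm_Padic_diff_rat_le[OF X(1), of k]) (auto intro: less_imp_le)
  then show ?thesis using assms by (intro exI[of _ "X k"]) linarith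
qed

instance padic :: (prime_card) complete_space
proof
  fix F :: "nat \<Rightarrow> 'a padic"
  assume F: "Cauchy F"
  have "\<exists>q. padic_norm (F n - of_rat q) < inverse (real (Suc n))" for n
    by (rule padic_rat_dense) simp
  then obtain Q where Q: "\<And>n. padic_norm (F n - of_rat (Q n)) < inverse (real (Suc n))" by metis
  have small: "\<exists>k. \<forall>n\<ge>k. padic_norm (F n - of_rat (Q n)) < e" if e: "e > 0" for e
  proof -
    obtain k where k: "inverse (real (Suc k)) < e" using reals_Archimedean[OF e] by auto
    have "inverse (real (Suc n)) \<le> inverse (real (Suc k))" if "n \<ge> k" for n
      using that by (intro le_imp_inverse_le) auto
    then show ?thesis using k Q by (meson less_le_trans less_trans)
  qed
  note tri = padic_norm_diff_ultrametric and mc = padic_norm_minus_commute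
  have C: "padic_Cauchy CARD('a) Q" unfolding padic_Cauchy_def
  proof (intro allI impI)
    fix e :: real assume e: "e > 0"
    obtain k where k: "\<And>n. n \<ge> k \<Longrightarrow> padic_norm (F n - of_rat (Q n)) < e" using small[OF e] by blast
    obtain l where l: "\<And>m n. m \<ge> l \<Longrightarrow> n \<ge> l \<Longrightarrow> padic_norm (F m - F n) < e"
      using F e unfolding Cauchy_def dist_padic_def by blast
    have "padic_abs CARD('a) (Q m - Q n) < e" if "m \<ge> max k l" "n \<ge> max k l" for m n
    proof -
      have "padic_abs CARD('a) (Q m - Q n) = padic_norm (of_rat (Q m) - of_rat (Q n) :: 'a padic)"
        by (simp flip: padic_norm_of_rat add: of_rat_diff)
      also have "\<dots> < e"
        using tri[of "of_rat (Q m)" "of_rat (Q n)" "F m"] tri[of "F m" "of_rat (Q n)" "F n"]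
          k[of m] k[of n] l[of m n] that mc[of "F m" "of_rat (Q m)"] by auto
      finally show ?thesis .
    qed
    then show "\<exists>k. \<forall>m\<ge>k. \<forall>n\<ge>k. padic_abs CARD('a) (Q m - Q n) < e" by blast
  qed
  have "F \<longlonglongrightarrow> Padic Q" unfolding lim_sequentially
  proof (intro allI impI)
    fix e :: real assume e: "e > 0"
    obtain k where k: "\<And>n. n \<ge> k \<Longrightarrow> padic_norm (F n - of_rat (Q n)) < e" using small[OF e] by blast
    obtain l where l: "\<And>m n. m \<ge> l \<Longrightarrow> n \<ge> l \<Longrightarrow> padic_abs CARD('a) (Q m - Q n) < e / 2"
      using C e unfolding padic_Cauchy_def by (meson half_gt_zero)
    have "dist (F n) (Padic Q) < e" if "n \<ge> max k l" for n
    proof -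
      have "padic_norm (Padic Q - of_rat (Q n) :: 'a padic) \<le> e / 2"
        by (rule norm_Padic_diff_rat_le[OF C, of l]) (use l that in \<open>auto intro: less_imp_le\<close>)
      then show ?thesis
        using tri[of "F n" "Padic Q" "of_rat (Q n)"] k[of n] that e
          mc[of "Padic Q :: 'a padic" "of_rat (Q n)"] by (auto simp: dist_padic_def)
    qed
    then show "\<exists>k. \<forall>n\<ge>k. dist (F n) (Padic Q) < e" by blast
  qed
  then show "convergent F" by (auto simp: convergent_def)
qed

definition padic_ints :: "'p::prime_card padic set" where
  "padic_ints = {x. padic_norm x \<le> 1}"

definition padic_int_units :: "'p::prime_card padic set" where
  "padic_int_units = {u \<in> padic_ints. \<exists>v\<in>padic_ints. u * v = 1}"


section \<open>Local isometries and rational functions\<close>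

text \<open>
  Requiring \<open>cball a r \<subseteq> X\<close> makes sense of the condition for a map that is only given
  on the open set \<open>X\<close>.
\<close>

definition locally_isometric_on :: "'a::metric_space set \<Rightarrow> ('a \<Rightarrow> 'a) \<Rightarrow> bool" where
  "locally_isometric_on X g \<longleftrightarrow>
     (\<forall>a\<in>X. \<exists>r>0. cball a r \<subseteq> X \<and>
        (\<forall>x\<in>cball a r. \<forall>y\<in>cball a r. dist (g x) (g y) = dist x y))"

text \<open>
  The derivative of \<open>P / Q\<close>, as an element of the field of rational functions, so that an
  equation \<open>ratfun_deriv P Q = Fract P' Q'\<close> does not depend on the chosen representatives
  and is meaningful even if \<open>Q'\<close> has roots.
\<close>

definition ratfun_deriv :: "'a::field poly \<Rightarrow> 'a poly \<Rightarrow> 'a poly fract" where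
  "ratfun_deriv P Q = Fract (pderiv P * Q - P * pderiv Q) (Q\<^sup>2)"

end

theory Submission
  imports Defs
begin

text \<open>
  With \<open>u\<close> the quotient of the leading coefficients, \<open>f x = u * x + D x / Q1 x\<close>, where \<open>D\<close> has degree at most \<open>n\<close>
  and coefficients of absolute value at most \<open>M = p ^ (N - 1)\<close>. On a sphere of radius \<open>r > M\<close> the
  remainder \<open>D / Q1\<close> is bounded by \<open>M\<close> and Lipschitz with constant \<open>M / r < 1\<close>. Hence, since
  \<open>|u| = 1\<close>, \<open>f\<close> maps each such sphere isometrically to itself, and onto it by Banach's fixed point
  theorem. So \<open>f\<close> always is a locally isometric bijection of the complement of \<open>B\<close>, and both
  sides of the equivalence only concern \<open>f\<close> on \<open>B\<close>.
\<close>

section \<open>Norm rules and the discreteness of the value group\<close>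

lemma padic_norm_0 [simp]: "padic_norm 0 = 0"
  by simp

lemma padic_norm_1 [simp]: "padic_norm (1 :: 'p::prime_card padic) = 1"
  using padic_norm_of_rat[of 1, where 'p='p] by simp

lemma padic_norm_pos_iff: "0 < padic_norm x \<longleftrightarrow> x \<noteq> 0"
  by (metis less_le padic_norm_eq_0 padic_norm_nonneg)

lemma padic_norm_power: "padic_norm (x ^ k) = padic_norm x ^ k"
  by (induction k) (simp_all add: padic_norm_mult)

lemma padic_norm_divide: "padic_norm (x / y) = padic_norm x / padic_norm y"
proof (cases "y = 0")
  case False
  then have "padic_norm (x / y) * padic_norm y = padic_norm x"
    by (simp flip: padic_norm_mult)
  with False show ?thesis by (simp add: eq_divide_eq)
qed simp

lemma padic_norm_diff_le: "padic_norm (x - y) \<le> max (padic_norm x) (padic_norm y)"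
  using padic_norm_ultrametric[of x "- y"] by simp

text \<open>The larger term wins: otherwise \<open>x = (x + y) - y\<close> would have norm below
  \<open>padic_norm x\<close>.\<close>

lemma padic_norm_add_eq:
  assumes "padic_norm y < padic_norm x"
  shows "padic_norm (x + y) = padic_norm x"
  using padic_norm_ultrametric[of x y] padic_norm_diff_le[of "x + y" y] assms by auto

lemma padic_norm_unit: "u \<in> padic_int_units \<Longrightarrow> padic_norm u = 1"
proof -
  assume "u \<in> padic_int_units"
  then obtain v where u: "padic_norm u \<le> 1" and v: "padic_norm v \<le> 1" "u * v = 1"
    by (auto simp: padic_int_units_def padic_ints_def)
  have "padic_norm u * padic_norm v = 1" using v(2) by (simp flip: padic_norm_mult)
  moreover have "padic_norm u * padic_norm v \<le> padic_norm u"
    using v(1) by (simp add: mult_left_le)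
  ultimately show ?thesis using u by simp
qed

lemma padic_norm_sum_le:
  assumes "0 \<le> K" "\<And>i. i \<in> A \<Longrightarrow> padic_norm (g i) \<le> K"
  shows "padic_norm (sum g A) \<le> K"
  using assms(2)
  by (induction A rule: infinite_finite_induct)
     (use assms(1) in \<open>auto intro!: order_trans[OF padic_norm_ultrametric]\<close>)

text \<open>A rational closer to \<open>x\<close> than \<open>0\<close> is has the same norm as
  \<open>x\<close>, and norms of nonzero rationals are integer powers of the prime.\<close>

lemma padic_norm_eq_powi:
  fixes x :: "'p::prime_card padic"
  assumes "x \<noteq> 0"
  obtains k where "padic_norm x = real CARD('p) powi k"
proof -
  obtain q where q: "padic_norm (x - of_rat q) < padic_norm x"
    using padic_rat_dense[of "padic_norm x" x] assms by (auto simp: padic_norm_pos_iff)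
  have "padic_norm (x + - (x - of_rat q)) = padic_norm x"
    using q by (intro padic_norm_add_eq) (simp only: padic_norm_minus)
  then have "padic_norm x = padic_abs CARD('p) q" by (simp add: padic_norm_of_rat)
  moreover have "q \<noteq> 0" using q by auto
  ultimately show ?thesis using that by (auto simp: padic_abs_def)
qed

text \<open>No norm lies strictly between consecutive powers of the prime, so strict coefficient
  bounds by \<open>p ^ N\<close> become bounds by \<open>p ^ (N - 1)\<close>, the radius of the
  ball.\<close>

lemma padic_norm_less_power_iff:
  fixes x :: "'p::prime_card padic"
  assumes "N > 0"
  shows "padic_norm x < real CARD('p) ^ N \<longleftrightarrow> padic_norm x \<le> real CARD('p) ^ (N - 1)"
proof (cases "x = 0")
  case True
  then show ?thesis by (simp add: prime_gt_0_nat[OF prime_card])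
next
  case False
  have p: "1 < real CARD('p)" using prime_gt_1_nat[OF prime_card[where 'a='p]] by simp
  obtain k where k: "padic_norm x = real CARD('p) powi k" by (rule padic_norm_eq_powi[OF False])
  have "real CARD('p) powi k < real CARD('p) powi int N \<longleftrightarrow> k \<le> int (N - 1)"
    using p assms power_int_strict_increasing[of k "int N" "real CARD('p)"]
      power_int_increasing[of "int N" k "real CARD('p)"] by fastforce
  moreover have "real CARD('p) powi k \<le> real CARD('p) powi int (N - 1) \<longleftrightarrow> k \<le> int (N - 1)"
    using p power_int_strict_increasing[of "int (N - 1)" k "real CARD('p)"]
      power_int_increasing[of k "int (N - 1)" "real CARD('p)"] by fastforce
  ultimately show ?thesis unfolding k power_int_of_nat by simp
qed

section \<open>Lipschitz estimates for powers and polynomials\<close>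

lemma padic_norm_power_diff_le:
  assumes "padic_norm x \<le> r" "padic_norm y \<le> r"
  shows "padic_norm (x ^ i - y ^ i) * r \<le> padic_norm (x - y) * r ^ i"
proof (induction i)
  case (Suc i)
  have r: "0 \<le> r" using assms(1) padic_norm_nonneg[of x] by linarith
  \<comment> \<open>This splitting drives the induction; the ultrametric inequality takes the
    maximum of the two terms, so no factor \<open>i\<close> arises.\<close>
  have "x ^ Suc i - y ^ Suc i = x * (x ^ i - y ^ i) + (x - y) * y ^ i"
    by (simp add: algebra_simps)
  then have "padic_norm (x ^ Suc i - y ^ Suc i)
      \<le> max (padic_norm x * padic_norm (x ^ i - y ^ i)) (padic_norm (x - y) * padic_norm y ^ i)"
      (is "?l \<le> ?r")
    by (metis padic_norm_ultrametric padic_norm_mult padic_norm_power)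
  then have "?l * r \<le> ?r * r" using r by (rule mult_right_mono)
  then have "padic_norm (x ^ Suc i - y ^ Suc i) * r
      \<le> max (padic_norm x * (padic_norm (x ^ i - y ^ i) * r))
            (padic_norm (x - y) * padic_norm y ^ i * r)"
    using r by (simp only: max_mult_distrib_right mult.assoc if_True)
  also have "\<dots> \<le> r * (padic_norm (x - y) * r ^ i)"
  proof (rule max.boundedI)
    show "padic_norm x * (padic_norm (x ^ i - y ^ i) * r) \<le> r * (padic_norm (x - y) * r ^ i)"
      using assms(1) Suc r by (intro mult_mono[OF _ Suc]) auto
    have "padic_norm (x - y) * padic_norm y ^ i * r \<le> padic_norm (x - y) * r ^ i * r"
      using assms(2) r by (intro mult_right_mono mult_left_mono power_mono) auto
    then show "padic_norm (x - y) * padic_norm y ^ i * r \<le> r * (padic_norm (x - y) * r ^ i)"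
      by (simp add: mult_ac)
  qed
  finally show ?case by (simp add: mult_ac)
qed (use assms padic_norm_nonneg in auto)

lemma padic_norm_poly_le:
  assumes "0 \<le> K" "\<And>i. padic_norm (Polynomial.coeff P i) * padic_norm x ^ i \<le> K"
  shows "padic_norm (poly P x) \<le> K"
  unfolding poly_altdef using assms
  by (intro padic_norm_sum_le) (auto simp: padic_norm_mult padic_norm_power)

text \<open>Multiplying by \<open>r\<close> instead of using \<open>r ^ (i - 1)\<close> avoids truncated subtraction.\<close>

lemma padic_norm_poly_diff_le:
  assumes "padic_norm x \<le> r" "padic_norm y \<le> r" "0 < r" "0 \<le> K"
    and "\<And>i. padic_norm (Polynomial.coeff P i) * r ^ i \<le> K"
  shows "padic_norm (poly P x - poly P y) * r \<le> K * padic_norm (x - y)"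
proof -
  have "padic_norm (Polynomial.coeff P i * (x ^ i - y ^ i)) \<le> K * padic_norm (x - y) / r" for i
  proof -
    have "padic_norm (Polynomial.coeff P i) * (padic_norm (x ^ i - y ^ i) * r)
        \<le> padic_norm (Polynomial.coeff P i) * (padic_norm (x - y) * r ^ i)"
      by (intro mult_left_mono padic_norm_power_diff_le assms) simp
    also have "\<dots> \<le> K * padic_norm (x - y)"
      using mult_right_mono[OF assms(5)[of i], of "padic_norm (x - y)"] by (simp add: mult_ac)
    finally show ?thesis using assms(3) by (simp add: pos_le_divide_eq padic_norm_mult mult_ac)
  qed
  then have "padic_norm (\<Sum>i\<le>degree P. Polynomial.coeff P i * (x ^ i - y ^ i)) \<le> K * padic_norm (x - y) / r"
    using assms by (intro padic_norm_sum_le) auto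
  then show ?thesis
    using assms(3) by (simp add: poly_altdef pos_le_divide_eq sum_subtractf right_diff_distrib)
qed

section \<open>Perturbations of a linear map outside the ball of radius \<open>M\<close>\<close>

locale padic_linear_at_infinity =
  fixes u :: "'p::prime_card padic" and D Q :: "'p padic poly" and n :: nat and M :: real
  assumes norm_u: "padic_norm u = 1"
    and deg_D: "degree D \<le> n" and deg_Q: "degree Q = n"
    and norm_lead: "padic_norm (lead_coeff Q) = 1"
    and coeff_D: "\<And>i. padic_norm (Polynomial.coeff D i) \<le> M"
    and coeff_Q: "\<And>j. j < n \<Longrightarrow> padic_norm (Polynomial.coeff Q j) \<le> M"
    and M: "1 \<le> M"
begin

definition remainder :: "'p padic \<Rightarrow> 'p padic" where
  "remainder x = poly D x / poly Q x"

lemma coeff_D_le: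
  assumes "M < r"
  shows "padic_norm (Polynomial.coeff D i) * r ^ i \<le> M * r ^ n"
proof (cases "i \<le> n")
  case True
  then show ?thesis using assms M coeff_D[of i] by (intro mult_mono power_increasing) auto
next
  case False
  then have "Polynomial.coeff D i = 0" using deg_D by (intro Polynomial.coeff_eq_0) simp
  then show ?thesis using M assms by simp
qed

text \<open>Since \<open>M < r\<close>, this bound is strictly below \<open>r ^ n\<close>, the size
  of the leading term; \<open>norm_Q\<close> rests on this gap.\<close>

lemma coeff_Q_less:
  assumes "M < r" "j < n"
  shows "padic_norm (Polynomial.coeff Q j) * r ^ j \<le> M * r ^ (n - 1)"
  using assms M coeff_Q[of j] by (intro mult_mono power_increasing) auto

lemma coeff_Q_le:
  assumes "M < r"
  shows "padic_norm (Polynomial.coeff Q j) * r ^ j \<le> r ^ n"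
proof -
  consider "j < n" | "j = n" | "j > n" by linarith
  then show ?thesis
  proof cases
    case 1
    have "M * r ^ (n - 1) \<le> r * r ^ (n - 1)" using assms M by (intro mult_right_mono) auto
    also have "\<dots> = r ^ n" using 1 by (simp flip: power_Suc)
    finally show ?thesis using coeff_Q_less[OF assms 1] by linarith
  next
    case 2
    then show ?thesis using norm_lead deg_Q by simp
  next
    case 3
    then have "Polynomial.coeff Q j = 0" using deg_Q by (intro Polynomial.coeff_eq_0) simp
    then show ?thesis using M assms by simp
  qed
qed

lemma norm_D:
  assumes "M < padic_norm x"
  shows "padic_norm (poly D x) \<le> M * padic_norm x ^ n"
  using M by (intro padic_norm_poly_le coeff_D_le assms) auto

lemma norm_Q:
  assumes "M < padic_norm x"
  shows "padic_norm (poly Q x) = padic_norm x ^ n"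
\<comment> \<open>The constant case is separate because \<open>r * r ^ (n - 1) = r ^ n\<close> needs
  \<open>n > 0\<close>.\<close>
proof (cases "n = 0")
  case True
  then show ?thesis using deg_Q norm_lead by (auto elim: degree_eq_zeroE)
next
  case False
  have "padic_norm (\<Sum>j<n. Polynomial.coeff Q j * x ^ j) \<le> M * padic_norm x ^ (n - 1)"
    using coeff_Q_less[OF assms] M
    by (intro padic_norm_sum_le) (auto simp: padic_norm_mult padic_norm_power)
  also have "\<dots> < padic_norm x * padic_norm x ^ (n - 1)"
    using assms M by (intro mult_strict_right_mono) auto
  also have "\<dots> = padic_norm (Polynomial.coeff Q n * x ^ n)"
    using norm_lead deg_Q False
    by (simp add: padic_norm_mult padic_norm_power flip: power_Suc)
  finally have "padic_norm (Polynomial.coeff Q n * x ^ n + (\<Sum>j<n. Polynomial.coeff Q j * x ^ j))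
      = padic_norm (Polynomial.coeff Q n * x ^ n)"
    by (rule padic_norm_add_eq)
  moreover have "poly Q x = Polynomial.coeff Q n * x ^ n + (\<Sum>j<n. Polynomial.coeff Q j * x ^ j)"
    unfolding poly_altdef deg_Q by (simp add: lessThan_Suc_atMost[symmetric])
  ultimately show ?thesis using norm_lead deg_Q by (simp add: padic_norm_mult padic_norm_power)
qed

lemma norm_remainder:
  assumes "M < padic_norm x"
  shows "padic_norm (remainder x) \<le> M"
  using norm_D[OF assms] assms M
  by (simp add: remainder_def padic_norm_divide norm_Q pos_divide_le_eq)

text \<open>Over the common denominator, of norm \<open>r ^ n * r ^ n\<close>, the numerator
  combines the increments of \<open>D\<close> and \<open>Q\<close>. On the sphere these have
  Lipschitz constants \<open>M * r ^ n / r\<close> and \<open>r ^ n / r\<close>, and their cofactors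
  are at most \<open>r ^ n\<close> and \<open>M * r ^ n\<close>.\<close>

lemma norm_remainder_diff:
  assumes x: "padic_norm x = r" and y: "padic_norm y = r" and r: "M < r"
  shows "padic_norm (remainder x - remainder y) \<le> M / r * padic_norm (x - y)"
proof -
  let ?d = "padic_norm (x - y)"
  have r0: "0 < r" using r M by simp
  have Qx: "padic_norm (poly Q x) = r ^ n" and Qy: "padic_norm (poly Q y) = r ^ n"
    using norm_Q x y r by auto
  then have nz: "poly Q x \<noteq> 0" "poly Q y \<noteq> 0" using r0 by (metis padic_norm_0 power_not_zero less_irrefl)+
  have "(remainder x - remainder y) * (poly Q x * poly Q y)
      = (poly D x - poly D y) * poly Q y - poly D y * (poly Q x - poly Q y)"
    using nz by (simp add: remainder_def field_simps)
  then have "padic_norm (remainder x - remainder y) * (r ^ n * r ^ n)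
      \<le> max (padic_norm (poly D x - poly D y) * r ^ n)
            (padic_norm (poly D y) * padic_norm (poly Q x - poly Q y))"
      (is "?lhs \<le> max ?a ?b")
    by (metis padic_norm_diff_le padic_norm_mult Qx Qy)
  \<comment> \<open>The extra factor \<open>r\<close> gives both terms the shape of
    \<open>padic_norm_poly_diff_le\<close>; it ends up as the denominator of
    \<open>M / r\<close>.\<close>
  then have "?lhs * r \<le> max ?a ?b * r" using r0 by (intro mult_right_mono) auto
  also have "\<dots> = max (?a * r) (?b * r)" using r0 by (simp add: max_mult_distrib_right)
  also have "\<dots> \<le> M * ?d * (r ^ n * r ^ n)"
  proof (rule max.boundedI)
    have "padic_norm (poly D x - poly D y) * r \<le> M * r ^ n * ?d"
      using x y r r0 M by (intro padic_norm_poly_diff_le coeff_D_le) auto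
    from mult_right_mono[OF this, of "r ^ n"] show "?a * r \<le> M * ?d * (r ^ n * r ^ n)"
      using r0 by (simp add: mult_ac)
    have "padic_norm (poly D y) * (padic_norm (poly Q x - poly Q y) * r) \<le> (M * r ^ n) * (r ^ n * ?d)"
      using x y r r0 M norm_D[of y] by (intro mult_mono padic_norm_poly_diff_le coeff_Q_le) auto
    then show "?b * r \<le> M * ?d * (r ^ n * r ^ n)" by (simp add: mult_ac)
  qed
  finally have "(padic_norm (remainder x - remainder y) * r) * (r ^ n * r ^ n) \<le> M * ?d * (r ^ n * r ^ n)"
    by (simp add: mult_ac)
  then have "padic_norm (remainder x - remainder y) * r \<le> M * ?d"
    by (rule mult_right_le_imp_le) (use r0 in simp)
  then show ?thesis using r0 by (simp add: pos_le_divide_eq)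
qed

lemma norm_preserving:
  assumes "M < padic_norm x"
  shows "padic_norm (u * x + remainder x) = padic_norm x"
  using norm_remainder[OF assms] assms norm_u
  by (subst padic_norm_add_eq) (auto simp: padic_norm_mult)

text \<open>As \<open>M / r < 1\<close>, the increment of \<open>remainder\<close> is strictly
  smaller than that of \<open>u * x\<close>, so the linear part alone determines the
  distance.\<close>

lemma sphere_isometry:
  assumes x: "padic_norm x = r" and y: "padic_norm y = r" and r: "M < r"
  shows "dist (u * x + remainder x) (u * y + remainder y) = dist x y"
proof (cases "x = y")
  case False
  then have "0 < padic_norm (x - y)" by (simp add: padic_norm_pos_iff)
  then have "M / r * padic_norm (x - y) < 1 * padic_norm (x - y)"
    using r M by (intro mult_strict_right_mono) auto
  then have "padic_norm (remainder x - remainder y) < padic_norm (u * (x - y))"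
    using norm_remainder_diff[OF assms] norm_u by (simp add: padic_norm_mult)
  from padic_norm_add_eq[OF this] have "padic_norm (u * (x - y) + (remainder x - remainder y))
      = padic_norm (x - y)" using norm_u by (simp add: padic_norm_mult)
  then show ?thesis by (simp add: dist_padic_def algebra_simps)
qed simp

text \<open>
  A preimage of \<open>y\<close> is a fixed point of \<open>x \<mapsto> (y - remainder x) / u\<close>, which contracts the
  sphere through \<open>y\<close>.
\<close>

lemma sphere_surj:
  assumes y: "M < padic_norm y"
  shows "\<exists>x. padic_norm x = padic_norm y \<and> u * x + remainder x = y"
proof -
  define r where "r = padic_norm y"
  define g where "g x = (y - remainder x) / u" for x
  have S: "sphere 0 r = {x :: 'p padic. padic_norm x = r}"
    by (auto simp: sphere_def dist_padic_def)
  have u0: "u \<noteq> 0" using norm_u by auto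
  have "\<exists>!x\<in>sphere 0 r. g x = x"
  proof (rule Banach_fix[where c = "M / r"])
    show "complete (sphere 0 r :: 'p padic set)"
      unfolding complete_eq_closed sphere_def by (intro closed_Collect_eq continuous_intros)
    show "sphere 0 r \<noteq> ({} :: 'p padic set)" unfolding S by (auto simp: r_def)
    show "0 \<le> M / r" "M / r < 1" using y M by (auto simp: r_def)
    show "g ` sphere 0 r \<subseteq> sphere 0 r" unfolding S
    proof (rule image_subsetI)
      fix x assume "x \<in> {x :: 'p padic. padic_norm x = r}"
      then have x: "padic_norm x = r" by simp
      \<comment> \<open>\<open>remainder x\<close> has norm at most \<open>M\<close>, so subtracting
        it from \<open>y\<close> does not leave the sphere.\<close>
      have "padic_norm (y + - remainder x) = padic_norm y"
        using norm_remainder[of x] x y by (intro padic_norm_add_eq) (auto simp: r_def)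
      then show "g x \<in> {x. padic_norm x = r}"
        using norm_u by (simp add: g_def padic_norm_divide r_def)
    qed
    fix x z :: "'p padic" assume "x \<in> sphere 0 r" "z \<in> sphere 0 r"
    then have "padic_norm x = r" "padic_norm z = r" unfolding S by simp_all
    then have "padic_norm (remainder z - remainder x) \<le> M / r * padic_norm (z - x)"
      using y by (intro norm_remainder_diff) (auto simp: r_def)
    moreover have "g x - g z = (remainder z - remainder x) / u"
      by (simp add: g_def diff_divide_distrib)
    ultimately show "dist (g x) (g z) \<le> M / r * dist x z"
      using norm_u by (simp add: dist_padic_def padic_norm_divide padic_norm_minus_commute)
  qed
  then obtain x where "padic_norm x = r" "g x = x" unfolding S by auto
  then show ?thesis using u0 by (intro exI[of _ x]) (auto simp: g_def r_def field_simps)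
qed

end

section \<open>Splitting the map along the ball and its complement\<close>

theorem proposition5p5:
  fixes P1 Q1 P2 Q2 :: "'p::prime_card padic poly"
    and f :: "'p padic \<Rightarrow> 'p padic"
    and n n' N :: nat
    and B :: "'p padic set"
  assumes "degree P1 = n + 1" and "lead_coeff P1 \<in> padic_int_units"
    and "degree Q1 = n" and "lead_coeff Q1 \<in> padic_int_units"
    and "\<forall>x. poly Q1 x \<noteq> 0"
    and "f = (\<lambda>x. poly P1 x / poly Q1 x)"
    and "ratfun_deriv P1 Q1 = Fract P2 Q2"
    and "degree P2 = n'" and "lead_coeff P2 \<in> padic_int_units"
    and "degree Q2 = n'" and "lead_coeff Q2 \<in> padic_int_units"
    and "N > 0"
    and "\<forall>i\<le>n. padic_norm (Polynomial.coeff P1 i) < real CARD('p) ^ N"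
    and "\<forall>j<n. padic_norm (Polynomial.coeff Q1 j) < real CARD('p) ^ N"
    and "\<forall>x. padic_norm x \<ge> real CARD('p) ^ N \<longrightarrow>
               padic_norm (poly P2 x) = padic_norm x ^ n' \<and> padic_norm (poly Q2 x) = padic_norm x ^ n'"
    and "B = cball 0 (real CARD('p) ^ (N - 1))"
  shows "(bij f \<and> locally_isometric_on UNIV f) \<longleftrightarrow>
         (f ` B \<subseteq> B \<and> bij_betw f B B \<and> locally_isometric_on B f)"
proof -
  define M where "M = real CARD('p) ^ (N - 1)"
  define u where "u = lead_coeff P1 / lead_coeff Q1"
  \<comment> \<open>Subtracting \<open>u * x * Q1\<close> cancels the leading term of
    \<open>P1\<close>, which leaves degree at most \<open>n\<close>.\<close>
  define D where "D = P1 - [:0, u:] * Q1"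
  have M: "1 \<le> M"
    using prime_gt_0_nat[OF prime_card[where 'a='p]] by (simp add: M_def)
  have P1: "padic_norm (Polynomial.coeff P1 i) \<le> M" if "i \<le> n" for i
    using assms(12,13) that by (simp add: M_def padic_norm_less_power_iff)
  have Q1: "padic_norm (Polynomial.coeff Q1 j) \<le> M" if "j < n" for j
    using assms(12,14) that by (simp add: M_def padic_norm_less_power_iff)
  have lead: "padic_norm (lead_coeff P1) = 1" "padic_norm (lead_coeff Q1) = 1"
    using assms(2,4) padic_norm_unit by auto
  then have norm_u: "padic_norm u = 1" by (simp add: u_def padic_norm_divide)
  have coeff_D: "Polynomial.coeff D i = Polynomial.coeff P1 i - (if i = 0 then 0 else u * Polynomial.coeff Q1 (i - 1))" for i
    by (cases i) (auto simp: D_def)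
  have D0: "Polynomial.coeff D i = 0" if "i > n" for i
  proof (cases "i = n + 1")
    case True
    then show ?thesis using assms(1,3) lead by (auto simp: coeff_D u_def)
  next
    case False
    then show ?thesis using assms(1,3) that by (simp add: coeff_D Polynomial.coeff_eq_0)
  qed
  interpret padic_linear_at_infinity u D Q1 n M
  proof
    show "degree D \<le> n" using D0 by (intro degree_le) auto
    fix i show "padic_norm (Polynomial.coeff D i) \<le> M"
    proof (cases "i \<le> n")
      case True
      \<comment> \<open>For \<open>i > 0\<close> the shifted index \<open>i - 1\<close> stays below
        \<open>n\<close>, so only the coefficients of \<open>Q1\<close> bounded by \<open>M\<close>
        occur.\<close>
      then have "padic_norm (if i = 0 then 0 else u * Polynomial.coeff Q1 (i - 1)) \<le> M"
        using Q1[of "i - 1"] norm_u M by (auto simp: padic_norm_mult)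
      then show ?thesis
        unfolding coeff_D using P1[OF True] by (intro order_trans[OF padic_norm_diff_le] max.boundedI)
    next
      case False
      then show ?thesis using D0 M by simp
    qed
  qed (use assms norm_u lead Q1 M in auto)
  have f: "f x = u * x + remainder x" for x
  proof -
    have "poly D x = poly P1 x - u * x * poly Q1 x" by (simp add: D_def)
    \<comment> \<open>\<open>Q1\<close> has no root, so it can be cancelled at every point, also
      inside \<open>B\<close>.\<close>
    then show ?thesis using assms(5) by (simp add: assms(6) remainder_def field_simps)
  qed
  have B: "x \<in> B \<longleftrightarrow> padic_norm x \<le> M" for x
    by (simp add: assms(16) M_def dist_padic_def)
  have norm_f: "padic_norm (f x) = padic_norm x" if "x \<notin> B" for x
    using norm_preserving that by (simp add: f B)
  have inj_C: "inj_on f (- B)"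
  proof (rule inj_onI)
    fix x y assume xy: "x \<in> - B" "y \<in> - B" "f x = f y"
    \<comment> \<open>\<open>f\<close> preserves norms off \<open>B\<close>, so equal values put
      both points on one sphere, where \<open>f\<close> is an isometry.\<close>
    then have "padic_norm x = padic_norm y" using norm_f by (metis ComplD)
    with xy(1) have "dist (f x) (f y) = dist x y"
      unfolding f by (intro sphere_isometry[of _ "padic_norm x"]) (auto simp: B)
    with xy(3) show "x = y" by simp
  qed
  have "f ` (- B) = - B"
  proof (intro equalityI subsetI)
    show "y \<in> - B" if "y \<in> f ` (- B)" for y using that norm_f B by auto
    show "y \<in> f ` (- B)" if "y \<in> - B" for y
      using that sphere_surj[of y] by (auto simp: f B image_iff not_le)
  qed
  with inj_C have bij_C: "bij_betw f (- B) (- B)" by (simp add: bij_betw_def)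
  \<comment> \<open>In an ultrametric space every point of a ball is a centre of it.\<close>
  have ball_B: "cball a r \<subseteq> B" if "a \<in> B" "r \<le> M" for a r
  proof
    fix x assume "x \<in> cball a r"
    then have "padic_norm (a - x) \<le> M" using that(2) by (simp add: dist_padic_def)
    then show "x \<in> B" using that(1) padic_norm_diff_le[of a "a - x"] by (auto simp: B)
  qed
  show ?thesis
  proof (intro iffI conjI; elim conjE)
    assume bij: "bij f" and iso: "locally_isometric_on UNIV f"
    \<comment> \<open>Removing the bijection of \<open>- B\<close> from that of the whole space
      leaves one of \<open>B\<close>.\<close>
    have "bij_betw f (UNIV - - B) (UNIV - - B)"
      using bij bij_C by (intro bij_betw_DiffI) auto
    then show bij_B: "bij_betw f B B" by (simp add: Compl_eq_Diff_UNIV[symmetric])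
    then show "f ` B \<subseteq> B" by (simp add: bij_betw_def)
    show "locally_isometric_on B f" unfolding locally_isometric_on_def
    proof
      fix a assume a: "a \<in> B"
      obtain r where "r > 0" "\<forall>x\<in>cball a r. \<forall>y\<in>cball a r. dist (f x) (f y) = dist x y"
        using iso unfolding locally_isometric_on_def by blast
      then show "\<exists>r>0. cball a r \<subseteq> B \<and>
          (\<forall>x\<in>cball a r. \<forall>y\<in>cball a r. dist (f x) (f y) = dist x y)"
        \<comment> \<open>Cutting the radius down to \<open>M\<close> keeps the ball inside
          \<open>B\<close>.\<close>
        using ball_B[OF a, of "min r M"] M by (intro exI[of _ "min r M"]) auto
    qed
  next
    assume "bij_betw f B B" and iso: "locally_isometric_on B f"
    then show "bij f" using bij_betw_combine[OF _ bij_C, of B B] by simp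
    show "locally_isometric_on UNIV f" unfolding locally_isometric_on_def
    proof
      fix a :: "'p padic"
      show "\<exists>r>0. cball a r \<subseteq> UNIV \<and>
          (\<forall>x\<in>cball a r. \<forall>y\<in>cball a r. dist (f x) (f y) = dist x y)"
      proof (cases "a \<in> B")
        case True
        then show ?thesis using iso unfolding locally_isometric_on_def by blast
      next
        case False
        then have a: "M < padic_norm a" by (simp add: B)
        \<comment> \<open>Points closer to \<open>a\<close> than \<open>padic_norm a\<close> have
          the norm of \<open>a\<close>. Half of it as radius makes this strict on a closed ball,
          which thus lies in one sphere.\<close>
        have near: "padic_norm x = padic_norm a" if "x \<in> cball a (padic_norm a / 2)" for x
        proof -
          have "padic_norm (x - a) < padic_norm a"
            using that a M by (simp add: dist_padic_def padic_norm_minus_commute)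
          from padic_norm_add_eq[OF this] show ?thesis by simp
        qed
        have "\<forall>x\<in>cball a (padic_norm a / 2). \<forall>y\<in>cball a (padic_norm a / 2).
            dist (f x) (f y) = dist x y"
          unfolding f by (intro ballI sphere_isometry[OF near near a])
        moreover have "0 < padic_norm a / 2" using a M by simp
        ultimately show ?thesis by blast
      qed
    qed
  qed
qed

end
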